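(* Let $\{z^k=(x^k,y^k)\}_{k=0}^{\infty}$ be the iterates of PDHG applied to the linear program $\min_{x\ge 0}\max_{y}\; c^Tx-y^TAx+b^Ty$ with step-size $0<s\le \frac{1}{2\|A\|_2}$ and initial point $z^0=(x^0,y^0)$, and let $z^*=(x^*,y^* )$ be the optimal solution to which they converge, $z^k\to z^*$. Let $(N,B_1,B_2)$ be the index partition associated with $z^*$, let $\delta$ be the non-degeneracy metric of $z^*$, let $R=2\left(\|z^0-z^*\|_2+\|z^*\|_2\right)+1$, and let $\alpha_{L_1}>0$ be the sharpness constant of the homogeneous linear inequality system $$A_B^Tv\le 0,\quad Au=0,\quad u_{N\cup B_2}\ge 0,\quad \tfrac1R(c^Tu-b^Tv)\le 0 .$$ Then for every $$k\ \ge\ K:=\max\left\{4,\frac{1}{s^2\alpha_{L_1}^2}\right\}\frac{256R^2}{\delta^2}+\frac{2}{s\|A\|_2}$$ it holds that $$\|z^k-z^*\|_2\le \frac{\delta}{2},\qquad x^k_N=0,\qquad x^k_{B_1}>0,\qquad c_N-A_N^Ty^k>0 ,$$ where vector inequalities are componentwise.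
   Context: Setting: $A\in\mathbb R^{m\times n}$ is nonzero, $b\in\mathbb R^m$, $c\in\mathbb R^n$. The LP is $\min\{c^Tx: Ax=b,\ x\ge 0\}$ with primal-dual form $\min_{x\ge0}\max_{y}\; c^Tx-y^TAx+b^Ty$. The LP is feasible and bounded. An optimal (primal-dual) solution is a saddle point $z^*=(x^*,y^* )$ of the primal-dual form, i.e. $Ax^*=b$, $x^*\ge0$, $A^Ty^*\le c$, $c^Tx^*\le b^Ty^*$. PDHG with step-size $s>0$ from $z^0=(x^0,y^0)$: for $k=0,1,\dots$, $x^{k+1}=\mathrm{proj}_{\mathbb R^n_+}\left(x^k-s(c-A^Ty^k)\right)$, $\ y^{k+1}=y^k-s\left(A(2x^{k+1}-x^k)-b\right)$. Notation: $\|A\|_2$ is the operator norm, $\|\cdot\|_2$ the Euclidean norm, $A_i$ the $i$-th column of $A$, $A_J=(A_j)_{j\in J}$ for $J\subset[n]=\{1,\dots,n\}$, $[\cdot]^+$ the componentwise positive part, $\mathrm{dist}$ the Euclidean distance. Index partition of an optimal solution $z^*=(x^*,y^* )$: $N=\{i: c_i-A_i^Ty^*>0\}$, $B_1=\{i: c_i-A_i^Ty^*=0,\ x_i^*>0\}$, $B_2=\{i: c_i-A_i^Ty^*=0,\ x_i^*=0\}$, and $B=B_1\cup B_2$. Non-degeneracy metric of $z^*$: $\delta=\min\left\{\min_{i\in N}\frac{c_i-A_i^Ty^*}{\|A\|_2},\ \min_{i\in B_1}x_i^*\right\}$ (a minimum over the empty set is $+\infty$). Sharpness constant: with $\mathcal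 K=\{(u,v)\in\mathbb R^{n}\times\mathbb R^m: A_B^Tv\le0,\ Au=0,\ u_{N\cup B_2}\ge0,\ \frac1R(c^Tu-b^Tv)\le0\}$, the sharpness constant $\alpha_{L_1}>0$ of the system is a constant such that for all $(u,v)\in\mathbb R^n\times\mathbb R^m$, $$\alpha_{L_1}\,\mathrm{dist}((u,v),\mathcal K)\le\left\|\left([A_B^Tv]^+,\ Au,\ [-u_{N\cup B_2}]^+,\ \tfrac1R[c^Tu-b^Tv]^+\right)\right\|_2 .$$ *)

theory Defs
  imports "HOL-Analysis.Analysis"
begin

definition nonneg_orthant :: "(real^'n) set" where
  "nonneg_orthant = {x. \<forall>i. 0 \<le> x $ i}"

definition op_norm :: "real^'n^'m \<Rightarrow> real" where
  "op_norm A = onorm (\<lambda>x. A *v x)"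

definition lp_feasible_set :: "real^'n^'m \<Rightarrow> real^'m \<Rightarrow> (real^'n) set" where
  "lp_feasible_set A b = {x. A *v x = b \<and> x \<in> nonneg_orthant}"

definition lp_feasible :: "real^'n^'m \<Rightarrow> real^'m \<Rightarrow> bool" where
  "lp_feasible A b \<longleftrightarrow> lp_feasible_set A b \<noteq> {}"

definition lp_bounded :: "real^'n^'m \<Rightarrow> real^'m \<Rightarrow> real^'n \<Rightarrow> bool" where
  "lp_bounded A b c \<longleftrightarrow> bdd_below ((\<lambda>x. c \<bullet> x) ` lp_feasible_set A b)"

definition lagrangian ::
  "real^'n^'m \<Rightarrow> real^'m \<Rightarrow> real^'n \<Rightarrow> real^'n \<Rightarrow> real^'m \<Rightarrow> real" where
  "lagrangian A b c x y = c \<bullet> x - y \<bullet> (A *v x) + b \<bullet> y"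

definition optimal_solution ::
  "real^'n^'m \<Rightarrow> real^'m \<Rightarrow> real^'n \<Rightarrow> (real^'n) \<times> (real^'m) \<Rightarrow> bool" where
  "optimal_solution A b c z \<longleftrightarrow>
     fst z \<in> nonneg_orthant \<and>
     (\<forall>x\<in>nonneg_orthant. \<forall>y.
        lagrangian A b c (fst z) y \<le> lagrangian A b c (fst z) (snd z) \<and>
        lagrangian A b c (fst z) (snd z) \<le> lagrangian A b c x (snd z))"

lemma lagrangian_alt:
  "lagrangian A b c x y = c \<bullet> x + y \<bullet> (b - A *v x)"
  "lagrangian A b c x y = (c - transpose A *v y) \<bullet> x + b \<bullet> y"
proof -
  show "lagrangian A b c x y = c \<bullet> x + y \<bullet> (b - A *v x)"
    by (simp add: lagrangian_def inner_diff_right inner_commute)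
  have "y \<bullet> (A *v x) = (transpose A *v y) \<bullet> x"
    by (simp add: dot_lmul_matrix)
  then show "lagrangian A b c x y = (c - transpose A *v y) \<bullet> x + b \<bullet> y"
    by (simp add: lagrangian_def inner_diff_left)
qed

lemma optimal_solution_iff_KKT:
  "optimal_solution A b c (x, y) \<longleftrightarrow>
     A *v x = b \<and> (\<forall>i. 0 \<le> x $ i) \<and>
     (\<forall>i. (transpose A *v y) $ i \<le> c $ i) \<and> c \<bullet> x \<le> b \<bullet> y"
  (is "?L \<longleftrightarrow> ?R")
proof
  assume L: ?L
  then have x: "x \<in> nonneg_orthant"
    and 1: "\<And>y'. lagrangian A b c x y' \<le> lagrangian A b c x y"
    and 2: "\<And>x'. x' \<in> nonneg_orthant \<Longrightarrow> lagrangian A b c x y \<le> lagrangian A b c x' y"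
    by (auto simp: optimal_solution_def)
  have "(b - A *v x) \<bullet> (b - A *v x) \<le> 0"
    using 1[of "y + (b - A *v x)"] by (simp add: lagrangian_alt(1) inner_add_left)
  then have Ax: "A *v x = b"
    by (metis inner_eq_zero_iff inner_ge_zero order_antisym right_minus_eq)
  define r where "r = c - transpose A *v y"
  have lag: "lagrangian A b c x' y = r \<bullet> x' + b \<bullet> y" for x'
    by (simp only: lagrangian_alt(2) r_def)
  have r: "0 \<le> r $ i" for i
  proof -
    have "x + axis i 1 \<in> nonneg_orthant"
      using x by (auto simp: nonneg_orthant_def axis_def)
    from 2[OF this] show ?thesis
      by (simp add: lag inner_add_right inner_axis)
  qed
  have "(0::real^'a) \<in> nonneg_orthant" by (simp add: nonneg_orthant_def)
  from 2[OF this] have "r \<bullet> x \<le> 0" by (simp add: lag)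
  moreover have "c \<bullet> x = r \<bullet> x + b \<bullet> y"
    using lagrangian_alt[of A b c x y] Ax by (simp add: r_def)
  moreover have "(transpose A *v y) $ i \<le> c $ i" for i
    using r[of i] by (simp add: r_def)
  ultimately show ?R
    using Ax x by (simp add: nonneg_orthant_def)
next
  assume R: ?R
  define r where "r = c - transpose A *v y"
  have nn: "0 \<le> r \<bullet> x'" if "x' \<in> nonneg_orthant" for x'
  proof -
    have "0 \<le> r $ i" for i using R by (simp add: r_def)
    then show ?thesis
      using that by (simp add: inner_vec_def nonneg_orthant_def sum_nonneg)
  qed
  have "c \<bullet> x = r \<bullet> x + b \<bullet> y"
    using lagrangian_alt[of A b c x y] R by (simp add: r_def)
  with R have "r \<bullet> x \<le> 0" by simp
  moreover have "lagrangian A b c x' y = r \<bullet> x' + b \<bullet> y" for x'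
    by (simp add: lagrangian_alt(2) r_def)
  ultimately have "lagrangian A b c x y \<le> lagrangian A b c x' y"
    if "x' \<in> nonneg_orthant" for x'
    using nn[OF that] by simp
  moreover have "lagrangian A b c x y' \<le> lagrangian A b c x y" for y'
    using R by (simp add: lagrangian_alt(1))
  ultimately show ?L
    using R by (simp add: optimal_solution_def nonneg_orthant_def)
qed

definition pdhg_step ::
  "real^'n^'m \<Rightarrow> real^'m \<Rightarrow> real^'n \<Rightarrow> real \<Rightarrow> (real^'n) \<times> (real^'m) \<Rightarrow> (real^'n) \<times> (real^'m)"
where
  "pdhg_step A b c s z =
     (let x = fst z; y = snd z;
          x' = closest_point nonneg_orthant (x - s *\<^sub>R (c - transpose A *v y));
          y' = y - s *\<^sub>R (A *v (2 *\<^sub>R x' - x) - b)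
      in (x', y'))"

primrec pdhg ::
  "real^'n^'m \<Rightarrow> real^'m \<Rightarrow> real^'n \<Rightarrow> real \<Rightarrow> (real^'n) \<times> (real^'m) \<Rightarrow> nat \<Rightarrow>
   (real^'n) \<times> (real^'m)"
where
  "pdhg A b c s z0 0 = z0"
| "pdhg A b c s z0 (Suc k) = pdhg_step A b c s (pdhg A b c s z0 k)"

definition reduced_cost ::
  "real^'n^'m \<Rightarrow> real^'n \<Rightarrow> real^'m \<Rightarrow> 'n \<Rightarrow> real" where
  "reduced_cost A c y i = c $ i - column i A \<bullet> y"

definition idx_N :: "real^'n^'m \<Rightarrow> real^'n \<Rightarrow> (real^'n) \<times> (real^'m) \<Rightarrow> 'n set" where
  "idx_N A c z = {i. reduced_cost A c (snd z) i > 0}"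

definition idx_B1 :: "real^'n^'m \<Rightarrow> real^'n \<Rightarrow> (real^'n) \<times> (real^'m) \<Rightarrow> 'n set" where
  "idx_B1 A c z = {i. reduced_cost A c (snd z) i = 0 \<and> fst z $ i > 0}"

definition idx_B2 :: "real^'n^'m \<Rightarrow> real^'n \<Rightarrow> (real^'n) \<times> (real^'m) \<Rightarrow> 'n set" where
  "idx_B2 A c z = {i. reduced_cost A c (snd z) i = 0 \<and> fst z $ i = 0}"

definition idx_B :: "real^'n^'m \<Rightarrow> real^'n \<Rightarrow> (real^'n) \<times> (real^'m) \<Rightarrow> 'n set" where
  "idx_B A c z = idx_B1 A c z \<union> idx_B2 A c z"

(* Extended-real valued: the infimum over an empty index set is \<infinity>; over a nonempty
   (finite) index set it is the minimum. *)
definition nondegeneracy ::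
  "real^'n^'m \<Rightarrow> real^'n \<Rightarrow> (real^'n) \<times> (real^'m) \<Rightarrow> ereal" where
  "nondegeneracy A c z =
     min (INF i\<in>idx_N A c z. ereal (reduced_cost A c (snd z) i / op_norm A))
         (INF i\<in>idx_B1 A c z. ereal (fst z $ i))"

definition sharpness_cone ::
  "real^'n^'m \<Rightarrow> real^'m \<Rightarrow> real^'n \<Rightarrow> real \<Rightarrow> (real^'n) \<times> (real^'m) \<Rightarrow>
   ((real^'n) \<times> (real^'m)) set"
where
  "sharpness_cone A b c R z =
     {(u, v). (\<forall>i\<in>idx_B A c z. column i A \<bullet> v \<le> 0) \<and>
              A *v u = 0 \<and>
              (\<forall>i\<in>idx_N A c z \<union> idx_B2 A c z. 0 \<le> u $ i) \<and>
              1 / R * (c \<bullet> u - b \<bullet> v) \<le> 0}"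

(* Positive part of the subvector w_J, padded by zeros outside J so that its type does not
   depend on J; the Euclidean norm is unaffected by the padding. *)
definition pos_part_on :: "'n set \<Rightarrow> ('n \<Rightarrow> real) \<Rightarrow> real^'n" where
  "pos_part_on J w = (\<chi> i. if i \<in> J then max 0 (w i) else 0)"

(* The norm of nested pairs is the Euclidean norm of the concatenated vector. *)
definition sharpness_residual ::
  "real^'n^'m \<Rightarrow> real^'m \<Rightarrow> real^'n \<Rightarrow> real \<Rightarrow> (real^'n) \<times> (real^'m) \<Rightarrow>
   real^'n \<Rightarrow> real^'m \<Rightarrow> (real^'n) \<times> (real^'m) \<times> (real^'n) \<times> real"
where
  "sharpness_residual A b c R z u v =
     (pos_part_on (idx_B A c z) (\<lambda>i. column i A \<bullet> v),
      A *v u,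
      pos_part_on (idx_N A c z \<union> idx_B2 A c z) (\<lambda>i. - u $ i),
      1 / R * max 0 (c \<bullet> u - b \<bullet> v))"

definition sharpness_constant ::
  "real^'n^'m \<Rightarrow> real^'m \<Rightarrow> real^'n \<Rightarrow> real \<Rightarrow> (real^'n) \<times> (real^'m) \<Rightarrow> real \<Rightarrow> bool"
where
  "sharpness_constant A b c R z \<alpha> \<longleftrightarrow>
     0 < \<alpha> \<and>
     (\<forall>u v. \<alpha> * infdist (u, v) (sharpness_cone A b c R z)
            \<le> norm (sharpness_residual A b c R z u v))"

end

theory Submission
  imports Defs
begin

text \<open>
  PDHG is a proximal point iteration for the KKT operator in the metric
  \<open>Q = I + s (0, A\<^sup>T; A, 0)\<close>, whose eigenvalues lie in \<open>[1/2, 3/2]\<close>. Hence it is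
  Fejer monotone towards every optimal solution, its steps are \<open>O(1 / sqrt k)\<close>, and so is the
  KKT residual. By sharpness \<open>z\<^sup>k - z\<^sup>*\<close> is then close to a point \<open>p\<close> of the cone, and
  \<open>z\<^sup>* + p\<close> is optimal as long as \<open>norm p \<le> \<delta>\<close>. Since \<open>z\<^sup>*\<close> is the limit, Fejer
  monotonicity towards \<open>z\<^sup>* + p\<close> bounds \<open>norm (z\<^sup>k - z\<^sup>*)\<close> by a multiple of
  \<open>norm (z\<^sup>k - z\<^sup>* - p)\<close>, which is less than \<open>\<delta> / 2\<close>. The condition \<open>norm p \<le> \<delta>\<close> is
  available because short steps cannot jump from outside the ball of radius \<open>\<delta>\<close> into the one
  of radius \<open>\<delta> / 2\<close>. In that ball the reduced costs on \<open>N\<close> are at least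
  \<open>op_norm A * \<delta> / 2\<close>, which drives these coordinates to zero within
  \<open>2 / (s * op_norm A)\<close> steps.
\<close>

section \<open>Operator norm and projection\<close>

lemma norm_mult_vec_le: "norm (A *v x) \<le> op_norm A * norm x"
  for A :: "real^'n^'m"
  unfolding op_norm_def by (rule onorm) simp

lemma op_norm_nonneg: "0 \<le> op_norm A"
  for A :: "real^'n^'m"
  unfolding op_norm_def by (rule onorm_pos_le) simp

lemma op_norm_pos: "0 < op_norm A" if "A \<noteq> 0"
  for A :: "real^'n^'m"
proof -
  have "\<exists>x. A *v x \<noteq> 0"
    using that by (metis matrix_eq matrix_vector_mult_0)
  then show ?thesis
    unfolding op_norm_def by (subst onorm_pos_lt) auto
qed

text \<open>The transpose inherits the constant: pairing \<open>y v* A\<close> with itself moves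
  \<open>A\<close> to the other side, and one factor \<open>norm (y v* A)\<close> cancels.\<close>

lemma norm_vec_mult_le: "norm (y v* A) \<le> op_norm A * norm y"
  for A :: "real^'n^'m"
proof (cases "y v* A = 0")
  case True
  then show ?thesis by (simp add: op_norm_nonneg)
next
  case False
  have "(norm (y v* A))\<^sup>2 = y \<bullet> (A *v (y v* A))"
    by (simp add: dot_lmul_matrix[symmetric] power2_norm_eq_inner)
  also have "\<dots> \<le> norm y * norm (A *v (y v* A))"
    by (rule norm_cauchy_schwarz)
  also have "\<dots> \<le> norm y * (op_norm A * norm (y v* A))"
    by (intro mult_left_mono norm_mult_vec_le) simp
  finally show ?thesis
    using False by (simp add: power2_eq_square algebra_simps)
qed

lemma norm_column_le_op_norm: "norm (column i A) \<le> op_norm A"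
  for A :: "real^'n^'m"
  using norm_mult_vec_le[of A "axis i 1"] by (simp add: matrix_vector_mult_basis)

lemma column_inner: "column i A \<bullet> y = (y v* A) $ i"
  for A :: "real^'n^'m"
  by (simp add: column_def vector_matrix_mult_def inner_vec_def mult.commute)

lemma abs_column_inner_le: "\<bar>column i A \<bullet> y\<bar> \<le> op_norm A * norm y"
  for A :: "real^'n^'m"
proof -
  have "\<bar>column i A \<bullet> y\<bar> \<le> norm (column i A) * norm y"
    by (rule Cauchy_Schwarz_ineq2)
  also have "\<dots> \<le> op_norm A * norm y"
    by (intro mult_right_mono norm_column_le_op_norm) simp
  finally show ?thesis .
qed

lemma inner_vec_mult: "x \<bullet> (y v* A) = y \<bullet> (A *v x)"
  for A :: "real^'n^'m"
  by (subst inner_commute) (rule dot_lmul_matrix)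

text \<open>The orthant is a product of half-lines, so the distance is minimised in each coordinate
  separately.\<close>

lemma closest_point_nonneg_orthant:
  "closest_point nonneg_orthant w = (\<chi> i. max 0 (w $ i))"
  for w :: "real^'n"
proof (rule closest_point_unique[symmetric])
  have eq: "nonneg_orthant = {x :: real^'n. \<forall>i. 0 \<le> x \<bullet> axis i 1}"
    by (simp add: nonneg_orthant_def inner_axis)
  show "convex (nonneg_orthant :: (real^'n) set)"
    by (auto simp: convex_def nonneg_orthant_def)
  show "closed (nonneg_orthant :: (real^'n) set)"
    unfolding eq by (intro closed_Collect_all closed_Collect_le continuous_intros)
  show "(\<chi> i. max 0 (w $ i)) \<in> nonneg_orthant"
    by (simp add: nonneg_orthant_def)
  show "\<forall>z\<in>nonneg_orthant. dist w (\<chi> i. max 0 (w $ i)) \<le> dist w z"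
  proof
    fix z :: "real^'n" assume "z \<in> nonneg_orthant"
    then have "\<bar>w $ i - max 0 (w $ i)\<bar> \<le> \<bar>w $ i - z $ i\<bar>" for i
      by (auto simp: nonneg_orthant_def max_def) (smt (verit))
    then show "dist w (\<chi> i. max 0 (w $ i)) \<le> dist w z"
      unfolding dist_norm by (intro norm_le_componentwise_cart) simp
  qed
qed

lemma reduced_cost_eq: "reduced_cost A c y i = (c - y v* A) $ i"
  by (simp add: reduced_cost_def column_inner)

lemma fst_pdhg_step:
  "fst (pdhg_step A b c s z) $ i =
     max 0 (fst z $ i - s * reduced_cost A c (snd z) i)"
  by (simp add: pdhg_step_def Let_def closest_point_nonneg_orthant reduced_cost_def
      column_inner)

lemma norm_Pair_sq: "(norm (x, y))\<^sup>2 = (norm x)\<^sup>2 + (norm y)\<^sup>2"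
  by (simp add: norm_Pair)

section \<open>PDHG as a proximal point iteration\<close>

locale pdhg_problem =
  fixes A :: "real^'n^'m" and b :: "real^'m" and c :: "real^'n" and s :: real
  assumes s_pos: "0 < s" and s_op_norm: "s * op_norm A \<le> 1 / 2"
begin

definition Q :: "(real^'n) \<times> (real^'m) \<Rightarrow> (real^'n) \<times> (real^'m)" where
  "Q z = (fst z + s *\<^sub>R (snd z v* A), snd z + s *\<^sub>R (A *v fst z))"

definition qsq :: "(real^'n) \<times> (real^'m) \<Rightarrow> real" where
  "qsq z = z \<bullet> Q z"

lemma linear_vec_mult: "linear (\<lambda>y. y v* A)"
  using matrix_vector_mul_linear[of "transpose A"] by simp

lemmas vec_mult_simps =
  linear_add[OF linear_vec_mult] linear_diff[OF linear_vec_mult]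
  linear_scale[OF linear_vec_mult]

lemma linear_Q: "linear Q"
  by (rule linearI)
    (simp_all add: Q_def vec_mult_simps matrix_vector_right_distrib
      matrix_vector_mult_scaleR algebra_simps)

lemmas Q_simps = linear_add[OF linear_Q] linear_diff[OF linear_Q] linear_scale[OF linear_Q]

lemma inner_Q: "z \<bullet> Q z' = z \<bullet> z' + s * (snd z' \<bullet> (A *v fst z) + snd z \<bullet> (A *v fst z'))"
  by (simp add: Q_def inner_prod_def inner_add_right inner_vec_mult algebra_simps)

lemma inner_Q_commute: "z \<bullet> Q z' = z' \<bullet> Q z"
  by (simp add: inner_Q inner_commute)

lemma qsq_add: "qsq (z + z') = qsq z + 2 * (z' \<bullet> Q z) + qsq z'"
  using inner_Q_commute[of z z'] by (simp add: qsq_def Q_simps inner_simps)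

text \<open>\<open>Q\<close> minus the identity swaps the two blocks through \<open>A\<close> and
  its transpose, scaled by \<open>s\<close>; its norm is at most
  \<open>s * op_norm A\<close>.\<close>

lemma norm_Q_diff_le: "norm (Q z - z) \<le> norm z / 2"
proof -
  let ?a = "op_norm A"
  have "(norm (snd z v* A))\<^sup>2 \<le> (?a * norm (snd z))\<^sup>2"
    "(norm (A *v fst z))\<^sup>2 \<le> (?a * norm (fst z))\<^sup>2"
    by (intro power_mono norm_vec_mult_le norm_mult_vec_le norm_ge_zero)+
  then have "(norm (snd z v* A, A *v fst z))\<^sup>2 \<le> (?a * norm z)\<^sup>2"
    by (simp add: norm_prod_def power_mult_distrib algebra_simps)
  then have le: "norm (snd z v* A, A *v fst z) \<le> ?a * norm z"
    by (rule power2_le_imp_le) (simp add: op_norm_nonneg)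
  have "Q z - z = s *\<^sub>R (snd z v* A, A *v fst z)"
    by (simp add: Q_def prod_eq_iff)
  then have "norm (Q z - z) = s * norm (snd z v* A, A *v fst z)"
    using s_pos by (simp del: scaleR_Pair)
  also have "\<dots> \<le> s * (?a * norm z)"
    using le s_pos by (intro mult_left_mono) auto
  also have "\<dots> \<le> norm z / 2"
    using mult_right_mono[OF s_op_norm, of "norm z"] by simp
  finally show ?thesis .
qed

lemma norm_Q_le: "norm (Q z) \<le> 3 / 2 * norm z"
  using norm_triangle_ineq[of z "Q z - z"] norm_Q_diff_le[of z] by simp

lemma qsq_bounds: "(norm z)\<^sup>2 / 2 \<le> qsq z" "qsq z \<le> 3 / 2 * (norm z)\<^sup>2"
proof -
  have "\<bar>z \<bullet> (Q z - z)\<bar> \<le> norm z * norm (Q z - z)"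
    by (rule Cauchy_Schwarz_ineq2)
  also have "\<dots> \<le> norm z * (norm z / 2)"
    by (intro mult_left_mono norm_Q_diff_le) simp
  finally have "\<bar>z \<bullet> (Q z - z)\<bar> \<le> (norm z)\<^sup>2 / 2"
    by (simp add: power2_eq_square)
  moreover have "qsq z = (norm z)\<^sup>2 + z \<bullet> (Q z - z)"
    by (simp add: qsq_def inner_diff_right power2_norm_eq_inner)
  ultimately show "(norm z)\<^sup>2 / 2 \<le> qsq z" "qsq z \<le> 3 / 2 * (norm z)\<^sup>2"
    by linarith+
qed

lemma qsq_nonneg: "0 \<le> qsq z"
  using qsq_bounds(1)[of z] by (smt (verit) divide_nonneg_pos zero_le_power2)

lemma norm_sq_le_qsq: "(norm z)\<^sup>2 \<le> 2 * qsq z"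
  using qsq_bounds(1)[of z] by simp

text \<open>\<open>w\<close> is an element of the monotone operator
  \<open>F (x, y) = (c - A\<^sup>T y + N(x), A x - b)\<close> at \<open>z = (x, y)\<close>, where \<open>N\<close> is the
  normal cone of the nonnegative orthant.\<close>

definition kkt_residual ::
  "(real^'n) \<times> (real^'m) \<Rightarrow> (real^'n) \<times> (real^'m) \<Rightarrow> bool" where
  "kkt_residual z w \<longleftrightarrow>
     (\<forall>i. 0 \<le> fst z $ i) \<and> A *v fst z - b = snd w \<and>
     (\<forall>i. 0 \<le> (c - snd z v* A - fst w) $ i) \<and>
     fst z \<bullet> (c - snd z v* A - fst w) = 0"

lemma inner_nonneg_cart: "0 \<le> u \<bullet> v" if "\<And>i. 0 \<le> u $ i" "\<And>i. 0 \<le> v $ i"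
  for u v :: "real^'k"
  using that by (simp add: inner_vec_def sum_nonneg)

text \<open>The bilinear part of the operator is skew and cancels. What remains pairs each point
  with the slack \<open>g\<close> of the other; own pairings vanish by complementarity, cross
  pairings are nonnegative.\<close>

lemma kkt_residual_monotone:
  assumes "kkt_residual z w" "kkt_residual z' w'"
  shows "0 \<le> (z - z') \<bullet> (w - w')"
proof -
  define g where "g = c - snd z v* A - fst w"
  define g' where "g' = c - snd z' v* A - fst w'"
  have fw: "fst w - fst w' = - ((snd z - snd z') v* A) - (g - g')"
    by (simp add: g_def g'_def vec_mult_simps)
  have sw: "snd w - snd w' = A *v (fst z - fst z')"
    using assms by (simp add: kkt_residual_def matrix_vector_mult_diff_distrib)
      (metis add_diff_cancel_right diff_add_cancel diff_diff_eq2)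
  have "(z - z') \<bullet> (w - w') =
      (fst z - fst z') \<bullet> (fst w - fst w') + (snd z - snd z') \<bullet> (snd w - snd w')"
    by (simp add: inner_prod_def)
  also have "\<dots> = - ((fst z - fst z') \<bullet> (g - g'))"
    unfolding fw sw by (simp add: inner_diff_right dot_lmul_matrix[symmetric] inner_commute)
  also have "\<dots> = fst z \<bullet> g' + fst z' \<bullet> g"
    using assms by (simp add: kkt_residual_def g_def[symmetric] g'_def[symmetric] inner_simps)
  also have "\<dots> \<ge> 0"
    using assms by (intro add_nonneg_nonneg inner_nonneg_cart)
      (auto simp: kkt_residual_def g_def g'_def)
  finally show ?thesis .
qed

text \<open>The extrapolation \<open>2 x' - x\<close> in the dual step is exactly what makes the
  residual a multiple of \<open>Q (z - z')\<close> with a symmetric \<open>Q\<close>.\<close>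

lemma kkt_residual_pdhg_step:
  fixes z
  defines "z' \<equiv> pdhg_step A b c s z"
  shows "kkt_residual z' ((1 / s) *\<^sub>R Q (z - z'))"
proof -
  let ?w = "(1 / s) *\<^sub>R Q (z - z')"
  have x': "fst z' $ i = max 0 (fst z $ i - s * (c - snd z v* A) $ i)" for i
    by (simp add: z'_def fst_pdhg_step reduced_cost_def column_inner)
  have y': "snd z - snd z' = s *\<^sub>R (A *v (2 *\<^sub>R fst z' - fst z) - b)"
    by (simp add: z'_def pdhg_step_def Let_def)
  have "snd ?w = (1 / s) *\<^sub>R (snd z - snd z') + A *v (fst z - fst z')"
    using s_pos by (simp add: Q_def scaleR_add_right)
  also have "\<dots> = A *v (2 *\<^sub>R fst z' - fst z) - b + A *v (fst z - fst z')"
    unfolding y' using s_pos by simp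
  also have "\<dots> = A *v fst z' - b"
    by (simp only: matrix_vector_mult_diff_distrib matrix_vector_right_distrib scaleR_2) simp
  finally have dual: "A *v fst z' - b = snd ?w" ..
  \<comment> \<open>The slack is \<open>1 / s\<close> times the amount that the projection adds; it
    is nonnegative, and nonzero only where the projected coordinate is zero.\<close>
  have g: "c - snd z' v* A - fst ?w
      = (1 / s) *\<^sub>R (fst z' - (fst z - s *\<^sub>R (c - snd z v* A)))"
    using s_pos by (simp add: Q_def vec_mult_simps scaleR_add_right scaleR_diff_right)
  have "0 \<le> (c - snd z' v* A - fst ?w) $ i" for i
    unfolding g using s_pos x'[of i] by (simp add: max_def)
  moreover have "fst z' $ i * (c - snd z' v* A - fst ?w) $ i = 0" for i
    unfolding g using s_pos x'[of i] by (simp add: max_def)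
  then have "fst z' \<bullet> (c - snd z' v* A - fst ?w) = 0"
    unfolding inner_vec_def inner_real_def by (intro sum.neutral) blast
  moreover have "0 \<le> fst z' $ i" for i
    by (simp add: x')
  ultimately show ?thesis
    using dual unfolding kkt_residual_def by blast
qed

lemma kkt_residual_optimal:
  assumes "optimal_solution A b c z"
  shows "kkt_residual z 0"
proof -
  have opt: "A *v fst z = b" "\<And>i. 0 \<le> fst z $ i" "\<And>i. (snd z v* A) $ i \<le> c $ i"
    "c \<bullet> fst z \<le> b \<bullet> snd z"
    using assms optimal_solution_iff_KKT[of A b c "fst z" "snd z"] by auto
  have "fst z \<bullet> (c - snd z v* A) = c \<bullet> fst z - b \<bullet> snd z"
    using opt(1) by (simp add: inner_diff_right inner_vec_mult inner_commute)
  moreover have "0 \<le> fst z \<bullet> (c - snd z v* A)"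
    using opt by (intro inner_nonneg_cart) auto
  ultimately show ?thesis
    using opt by (simp add: kkt_residual_def)
qed

section \<open>Fejer monotonicity and decay of the steps\<close>

abbreviation iter :: "(real^'n) \<times> (real^'m) \<Rightarrow> nat \<Rightarrow> (real^'n) \<times> (real^'m)" where
  "iter z0 j \<equiv> pdhg A b c s z0 j"

lemma kkt_residual_iter:
  "kkt_residual (iter z0 (Suc j)) ((1 / s) *\<^sub>R Q (iter z0 j - iter z0 (Suc j)))"
  using kkt_residual_pdhg_step[of "iter z0 j"] by simp

text \<open>Monotonicity between the new iterate and \<open>z\<close>, whose residual is
  \<open>0\<close>, makes the cross term nonnegative when the old distance is expanded around the
  new one.\<close>

lemma fejer:
  assumes "optimal_solution A b c z"
  shows "qsq (iter z0 (Suc j) - z) + qsq (iter z0 j - iter z0 (Suc j)) \<le> qsq (iter z0 j - z)"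
proof -
  let ?p = "iter z0 (Suc j)" and ?r = "iter z0 j - iter z0 (Suc j)"
  have "0 \<le> (?p - z) \<bullet> ((1 / s) *\<^sub>R Q ?r - 0)"
    by (rule kkt_residual_monotone[OF kkt_residual_iter kkt_residual_optimal[OF assms]])
  then have "0 \<le> (?p - z) \<bullet> Q ?r"
    using s_pos by (simp add: zero_le_divide_iff)
  moreover have "qsq (iter z0 j - z) = qsq (?r + (?p - z))"
    by simp
  ultimately show ?thesis
    unfolding qsq_add by simp
qed

lemma qsq_dist_antimono:
  assumes "optimal_solution A b c z" "i \<le> j"
  shows "qsq (iter z0 j - z) \<le> qsq (iter z0 i - z)"
  using assms(2)
proof (induction j rule: dec_induct)
  case (step j)
  then show ?case
    using fejer[OF assms(1), of z0 j] qsq_nonneg[of "iter z0 j - iter z0 (Suc j)"] by linarith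
qed simp

text \<open>The residuals at two consecutive iterates are \<open>Q\<close> of the steps up to
  \<open>1 / s\<close>, so monotonicity says that \<open>?r'\<close> has nonnegative
  \<open>Q\<close>-product with \<open>?r - ?r'\<close>.\<close>

lemma qsq_step_Suc:
  "qsq (iter z0 (Suc j) - iter z0 (Suc (Suc j))) \<le> qsq (iter z0 j - iter z0 (Suc j))"
proof -
  let ?r = "iter z0 j - iter z0 (Suc j)"
    and ?r' = "iter z0 (Suc j) - iter z0 (Suc (Suc j))"
  have "0 \<le> ?r' \<bullet> ((1 / s) *\<^sub>R Q ?r - (1 / s) *\<^sub>R Q ?r')"
    by (rule kkt_residual_monotone[OF kkt_residual_iter kkt_residual_iter])
  also have "\<dots> = (1 / s) * (?r' \<bullet> Q (?r - ?r'))"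
    by (simp add: Q_simps inner_diff_right diff_divide_distrib add_divide_distrib)
  finally have "0 \<le> ?r' \<bullet> Q (?r - ?r')"
    using s_pos by (auto simp: zero_le_divide_iff)
  moreover have "qsq ?r = qsq (?r - ?r' + ?r')"
    by simp
  ultimately show ?thesis
    using qsq_nonneg[of "?r - ?r'"] unfolding qsq_add by linarith
qed

text \<open>The Fejer inequality telescopes, and the last step is the shortest; the distance term is
  kept to carry the induction.\<close>

lemma qsq_step_le:
  assumes "optimal_solution A b c z"
  shows "real (Suc j) * qsq (iter z0 j - iter z0 (Suc j)) + qsq (iter z0 (Suc j) - z)
    \<le> qsq (z0 - z)"
proof (induction j)
  case 0
  then show ?case using fejer[OF assms, of z0 0] by simp
next
  case (Suc j)
  let ?q = "\<lambda>j. qsq (iter z0 j - iter z0 (Suc j))"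
  have "real (Suc j) * ?q (Suc j) \<le> real (Suc j) * ?q j"
    by (intro mult_left_mono qsq_step_Suc) simp
  moreover have "real (Suc (Suc j)) * ?q (Suc j) = real (Suc j) * ?q (Suc j) + ?q (Suc j)"
    by (simp add: algebra_simps)
  ultimately show ?case
    using Suc fejer[OF assms, of z0 "Suc j"] by linarith
qed

lemma norm_step_le:
  assumes "optimal_solution A b c z"
  shows "(norm (iter z0 j - iter z0 (Suc j)))\<^sup>2 \<le> 3 * (norm (z0 - z))\<^sup>2 / real (Suc j)"
proof -
  let ?r = "iter z0 j - iter z0 (Suc j)"
  have "real (Suc j) * qsq ?r \<le> 3 / 2 * (norm (z0 - z))\<^sup>2"
    using qsq_step_le[OF assms, of j z0] qsq_nonneg[of "iter z0 (Suc j) - z"]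
      qsq_bounds(2)[of "z0 - z"] by linarith
  moreover have "real (Suc j) * (norm ?r)\<^sup>2 \<le> real (Suc j) * (2 * qsq ?r)"
    by (intro mult_left_mono norm_sq_le_qsq) simp
  ultimately have "real (Suc j) * (norm ?r)\<^sup>2 \<le> 3 * (norm (z0 - z))\<^sup>2"
    by linarith
  then show ?thesis
    by (simp add: field_simps)
qed

text \<open>The eigenvalue bounds of \<open>Q\<close> cost a factor \<open>sqrt 3\<close>, rounded
  up to \<open>2\<close>; this matches the \<open>2\<close> in \<open>R\<close>, so that every
  iterate has norm at most \<open>R\<close>.\<close>

lemma norm_dist_le:
  assumes "optimal_solution A b c z"
  shows "norm (iter z0 j - z) \<le> 2 * norm (z0 - z)"
proof (rule power2_le_imp_le)
  have "(norm (iter z0 j - z))\<^sup>2 \<le> 3 * (norm (z0 - z))\<^sup>2"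
    using norm_sq_le_qsq[of "iter z0 j - z"] qsq_dist_antimono[OF assms, of 0 j z0]
      qsq_bounds(2)[of "z0 - z"] by simp
  also have "\<dots> \<le> (2 * norm (z0 - z))\<^sup>2"
    by (simp add: power_mult_distrib)
  finally show "(norm (iter z0 j - z))\<^sup>2 \<le> (2 * norm (z0 - z))\<^sup>2" .
qed simp

text \<open>All distances to optimal points shrink in the \<open>Q\<close>-norm, so the limit of the iterates is
  at least as close to every optimal point as any iterate.\<close>

lemma qsq_limit_le:
  assumes "(\<lambda>j. iter z0 j) \<longlonglongrightarrow> zs" "optimal_solution A b c z"
  shows "qsq (zs - z) \<le> qsq (iter z0 j - z)"
proof (rule tendsto_upperbound)
  have diff: "(\<lambda>j. iter z0 j - z) \<longlonglongrightarrow> zs - z"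
    by (intro tendsto_diff assms(1) tendsto_const)
  have "bounded_linear Q"
    using linear_Q by (simp add: linear_linear)
  then have "(\<lambda>j. Q (iter z0 j - z)) \<longlonglongrightarrow> Q (zs - z)"
    using diff by (rule bounded_linear.tendsto)
  then show "(\<lambda>j. qsq (iter z0 j - z)) \<longlonglongrightarrow> qsq (zs - z)"
    unfolding qsq_def by (intro tendsto_inner diff)
  show "\<forall>\<^sub>F i in sequentially. qsq (iter z0 i - z) \<le> qsq (iter z0 j - z)"
    using eventually_ge_at_top[of j] by eventually_elim (rule qsq_dist_antimono[OF assms(2)])
qed simp

text \<open>The parallelogram law in the \<open>Q\<close>-norm bounds the squared distance to
  \<open>zs\<close> by four times that to \<open>z\<close>; passing to Euclidean norms costs
  \<open>2 * 3 / 2\<close>, hence \<open>12\<close>.\<close>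

lemma norm_limit_le:
  assumes "(\<lambda>j. iter z0 j) \<longlonglongrightarrow> zs" "optimal_solution A b c z"
  shows "(norm (iter z0 j - zs))\<^sup>2 \<le> 12 * (norm (iter z0 j - z))\<^sup>2"
proof -
  let ?u = "iter z0 j - z" and ?v = "zs - z"
  have "qsq (?u + (z - zs)) + qsq (?u - (z - zs)) = 2 * qsq ?u + 2 * qsq ?v"
    using inner_Q_commute by (simp add: qsq_def Q_simps inner_simps)
  then have "qsq (iter z0 j - zs) \<le> 2 * qsq ?u + 2 * qsq ?v"
    using qsq_nonneg[of "?u - (z - zs)"] by simp
  also have "\<dots> \<le> 4 * qsq ?u"
    using qsq_limit_le[OF assms, of j] by simp
  also have "\<dots> \<le> 6 * (norm ?u)\<^sup>2"
    using qsq_bounds(2)[of ?u] by simp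
  finally show ?thesis
    using norm_sq_le_qsq[of "iter z0 j - zs"] by linarith
qed

section \<open>Sharpness near the limit\<close>

lemma optimal_solutionD:
  assumes "optimal_solution A b c z"
  shows "A *v fst z = b" "0 \<le> fst z $ i" "0 \<le> reduced_cost A c (snd z) i"
    "fst z $ i * reduced_cost A c (snd z) i = 0" "c \<bullet> fst z = b \<bullet> snd z"
proof -
  have k: "kkt_residual z 0"
    by (rule kkt_residual_optimal[OF assms])
  then show "A *v fst z = b" and nn: "0 \<le> fst z $ i"
    and rc: "0 \<le> reduced_cost A c (snd z) i" for i
    by (auto simp: kkt_residual_def reduced_cost_def column_inner)
  have "(\<Sum>i\<in>UNIV. fst z $ i * reduced_cost A c (snd z) i) = 0"
    using k by (simp add: kkt_residual_def inner_vec_def reduced_cost_eq)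
  then have "\<forall>i\<in>UNIV. fst z $ i * reduced_cost A c (snd z) i = 0"
    using nn rc by (subst (asm) sum_nonneg_eq_0_iff) auto
  then show "fst z $ i * reduced_cost A c (snd z) i = 0" by simp
  have "fst z \<bullet> c = fst z \<bullet> (snd z v* A)"
    using k by (simp add: kkt_residual_def inner_diff_right)
  also have "\<dots> = snd z \<bullet> (A *v fst z)"
    by (rule inner_vec_mult)
  also have "\<dots> = b \<bullet> snd z"
    using k by (simp add: kkt_residual_def inner_commute)
  finally show "c \<bullet> fst z = b \<bullet> snd z" by (simp add: inner_commute)
qed

lemma optimal_index_cases:
  assumes "optimal_solution A b c z"
  shows "i \<in> idx_N A c z \<or> i \<in> idx_B1 A c z \<or> i \<in> idx_B2 A c z"
  using optimal_solutionD(2,3)[OF assms, of i]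
  by (auto simp: idx_N_def idx_B1_def idx_B2_def)

lemma optimal_fst_eq_0:
  assumes "optimal_solution A b c z" "i \<in> idx_N A c z \<union> idx_B2 A c z"
  shows "fst z $ i = 0"
  using optimal_solutionD(4)[OF assms(1), of i] assms(2)
  by (auto simp: idx_N_def idx_B2_def)

text \<open>A displacement of norm at most \<open>d\<close> lowers a coordinate by at most
  \<open>d\<close> and a reduced cost by at most \<open>d * op_norm A\<close>, which the slack on
  \<open>B1\<close> and \<open>N\<close> absorbs. All other signs and the duality gap are controlled
  by the cone itself.\<close>

lemma sharpness_cone_optimal:
  assumes opt: "optimal_solution A b c z" and p: "p \<in> sharpness_cone A b c R z"
    and "0 < R" and d: "norm p \<le> d"
    and N: "\<And>i. i \<in> idx_N A c z \<Longrightarrow> d * op_norm A \<le> reduced_cost A c (snd z) i"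
    and B1: "\<And>i. i \<in> idx_B1 A c z \<Longrightarrow> d \<le> fst z $ i"
  shows "optimal_solution A b c (z + p)"
proof -
  obtain u v where uv: "p = (u, v)" by (cases p)
  note opt' = optimal_solutionD[OF opt]
  have cone: "\<And>i. i \<in> idx_B A c z \<Longrightarrow> column i A \<bullet> v \<le> 0" "A *v u = 0"
    "\<And>i. i \<in> idx_N A c z \<union> idx_B2 A c z \<Longrightarrow> 0 \<le> u $ i" "c \<bullet> u \<le> b \<bullet> v"
    using p \<open>0 < R\<close> by (auto simp: sharpness_cone_def uv divide_le_0_iff)
  have "norm u \<le> d" "norm v \<le> d"
    using d norm_fst_le[of u v] norm_snd_le[of v u] by (auto simp: uv)
  have "0 \<le> fst (z + p) $ i" for i
  proof (cases "i \<in> idx_B1 A c z")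
    case True
    then show ?thesis
      using B1[OF True] component_le_norm_cart[of u i] \<open>norm u \<le> d\<close> by (simp add: uv)
  next
    case False
    then have "0 \<le> u $ i"
      using cone(3) optimal_index_cases[OF opt, of i] by blast
    then show ?thesis using opt'(2)[of i] by (simp add: uv)
  qed
  moreover have "0 \<le> reduced_cost A c (snd (z + p)) i" for i
  proof (cases "i \<in> idx_N A c z")
    case True
    have "column i A \<bullet> v \<le> op_norm A * norm v"
      using abs_column_inner_le[of i A v] by simp
    also have "\<dots> \<le> op_norm A * d"
      by (intro mult_left_mono \<open>norm v \<le> d\<close> op_norm_nonneg)
    finally show ?thesis
      using N[OF True] by (simp add: reduced_cost_def uv inner_add_right mult.commute)
  next
    case False
    then have "column i A \<bullet> v \<le> 0"
      using cone(1) optimal_index_cases[OF opt, of i] by (auto simp: idx_B_def)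
    then show ?thesis
      using opt'(3)[of i] by (simp add: reduced_cost_def uv inner_add_right)
  qed
  moreover have "z + p = (fst z + u, snd z + v)"
    by (simp add: uv prod_eq_iff)
  ultimately show ?thesis
    using opt'(1,5) cone(2,4)
    by (simp add: optimal_solution_iff_KKT reduced_cost_def column_inner matrix_vector_right_distrib inner_add_right)
qed

text \<open>The reduced-cost block is bounded by \<open>fst w\<close>, the equality block is
  \<open>snd w\<close>, and the sign block vanishes since \<open>fst z\<close> is nonnegative. The
  gap block contributes a second \<open>(norm w)\<^sup>2\<close>, whence the factor
  \<open>2\<close>.\<close>

lemma norm_sharpness_residual_le:
  assumes opt: "optimal_solution A b c zs" and k: "kkt_residual z w"
    and R: "norm z \<le> R" "0 < R"
  shows "(norm (sharpness_residual A b c R zs (fst (z - zs)) (snd (z - zs))))\<^sup>2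
    \<le> 2 * (norm w)\<^sup>2"
proof -
  let ?u = "fst (z - zs)" and ?v = "snd (z - zs)"
  note opt' = optimal_solutionD[OF opt]
  have "norm (pos_part_on (idx_B A c zs) (\<lambda>i. column i A \<bullet> ?v)) \<le> norm (fst w)"
  proof (rule norm_le_componentwise_cart)
    fix i
    have "column i A \<bullet> ?v \<le> - (fst w $ i)" if "i \<in> idx_B A c zs"
    proof -
      have "column i A \<bullet> snd zs = c $ i"
        using that by (auto simp: idx_B_def idx_B1_def idx_B2_def reduced_cost_def)
      moreover have "fst w $ i \<le> c $ i - column i A \<bullet> snd z"
        using k by (simp add: kkt_residual_def column_inner)
      ultimately show ?thesis by (simp add: inner_diff_right)
    qed
    then show "norm (pos_part_on (idx_B A c zs) (\<lambda>i. column i A \<bullet> ?v) $ i) \<le> norm (fst w $ i)"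
      by (auto simp: pos_part_on_def)
  qed
  then have 1: "(norm (pos_part_on (idx_B A c zs) (\<lambda>i. column i A \<bullet> ?v)))\<^sup>2 \<le> (norm (fst w))\<^sup>2"
    by (rule power_mono) simp
  have 2: "A *v ?u = snd w"
    using k opt'(1) by (simp add: kkt_residual_def matrix_vector_mult_diff_distrib)
  have 3: "pos_part_on (idx_N A c zs \<union> idx_B2 A c zs) (\<lambda>i. - ?u $ i) = 0"
    using k optimal_fst_eq_0[OF opt]
    by (auto simp: pos_part_on_def vec_eq_iff kkt_residual_def)
  have "c \<bullet> ?u - b \<bullet> ?v = c \<bullet> fst z - b \<bullet> snd z"
    using opt'(5) by (simp add: inner_diff_right)
  \<comment> \<open>By complementarity the duality gap is the product of \<open>z\<close> with its
    residual; dividing by \<open>R\<close> then absorbs \<open>norm z\<close>.\<close>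
  also have "\<dots> = fst z \<bullet> (c - snd z v* A) + snd z \<bullet> (A *v fst z - b)"
    by (simp add: inner_diff_right inner_vec_mult inner_commute)
  also have "\<dots> = z \<bullet> w"
    using k by (simp add: kkt_residual_def inner_prod_def inner_diff_right)
  also have "\<dots> \<le> norm z * norm w"
    by (rule norm_cauchy_schwarz)
  also have "\<dots> \<le> R * norm w"
    by (intro mult_right_mono R) simp
  finally have "max 0 (c \<bullet> ?u - b \<bullet> ?v) \<le> R * norm w"
    using R by simp
  then have "1 / R * max 0 (c \<bullet> ?u - b \<bullet> ?v) \<le> norm w"
    using R by (simp add: field_simps)
  moreover have "0 \<le> 1 / R * max 0 (c \<bullet> ?u - b \<bullet> ?v)"
    using R by (intro mult_nonneg_nonneg) auto
  ultimately have 4: "(norm (1 / R * max 0 (c \<bullet> ?u - b \<bullet> ?v)))\<^sup>2 \<le> (norm w)\<^sup>2"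
    by (intro power_mono) (simp_all only: real_norm_def abs_of_nonneg abs_ge_zero)
  have nw: "(norm w)\<^sup>2 = (norm (fst w))\<^sup>2 + (norm (snd w))\<^sup>2"
    by (simp add: norm_prod_def)
  have "p + (g + (0 + q)) \<le> 2 * (f + g)" if "p \<le> f" "q \<le> f + g" for p q f g :: real
    using that by simp
  from this[OF 1 4[unfolded nw]] show ?thesis
    unfolding sharpness_residual_def norm_Pair_sq 2 3 nw norm_zero zero_power2 .
qed

text \<open>A strict bound leaves room for a nearly closest point, even if the infimum is not
  attained.\<close>

lemma infdist_less_obtain:
  assumes "infdist x S < e" "S \<noteq> {}"
  obtains p where "p \<in> S" "dist x p < e"
  using assms by (auto simp: infdist_notempty cINF_less_iff[OF _ bdd_belowI2[of _ 0]])

end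

section \<open>Iterates beyond the threshold, for a finite non-degeneracy metric
  \<open>d\<close>\<close>

locale pdhg_limit = pdhg_problem A b c s
  for A :: "real^'n^'m" and b c s +
  fixes z0 zs :: "(real^'n) \<times> (real^'m)" and R \<alpha> d :: real
  assumes opt: "optimal_solution A b c zs"
    and lim: "(\<lambda>j. pdhg A b c s z0 j) \<longlonglongrightarrow> zs"
    and R_eq: "R = 2 * (norm (z0 - zs) + norm zs) + 1"
    and sharp: "sharpness_constant A b c R zs \<alpha>"
    and d_pos: "0 < d"
    and d_N: "\<And>i. i \<in> idx_N A c zs \<Longrightarrow> d * op_norm A \<le> reduced_cost A c (snd zs) i"
    and d_B1: "\<And>i. i \<in> idx_B1 A c zs \<Longrightarrow> d \<le> fst zs $ i"
begin

text \<open>The threshold without its last summand, which pays for driving the coordinates on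
  \<open>N\<close> to zero.\<close>

definition K0 :: real where
  "K0 = max 4 (1 / (s\<^sup>2 * \<alpha>\<^sup>2)) * (256 * R\<^sup>2 / d\<^sup>2)"

lemma R_pos: "0 < R"
  unfolding R_eq by (simp add: add_nonneg_pos)

lemma K0_pos: "0 < K0"
  unfolding K0_def using R_pos d_pos by (intro mult_pos_pos) auto

lemma norm_start_le: "(norm (z0 - zs))\<^sup>2 \<le> R\<^sup>2 / 4"
proof -
  have "(norm (z0 - zs))\<^sup>2 \<le> (R / 2)\<^sup>2"
    by (intro power_mono) (simp_all add: R_eq)
  then show ?thesis by (simp add: power_divide)
qed

text \<open>This uses the entry \<open>4\<close> of the maximum: the squared step is at most
  \<open>3 / 4 * d\<^sup>2 / 1024\<close>.\<close>

lemma step_small: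
  assumes "K0 \<le> real (Suc j)"
  shows "norm (iter z0 j - iter z0 (Suc j)) \<le> d / 16"
proof (rule power2_le_imp_le)
  let ?n = "real (Suc j)"
  have "4 * (256 * R\<^sup>2 / d\<^sup>2) \<le> K0"
    unfolding K0_def by (intro mult_right_mono) auto
  then have "1024 * R\<^sup>2 / d\<^sup>2 \<le> ?n"
    using assms by simp
  then have "1024 * R\<^sup>2 \<le> ?n * d\<^sup>2"
    by (subst (asm) pos_divide_le_eq) (use d_pos in auto)
  then have "R\<^sup>2 / ?n \<le> d\<^sup>2 / 1024"
    by (simp add: field_simps)
  moreover have "3 * (norm (z0 - zs))\<^sup>2 / ?n \<le> 3 * (R\<^sup>2 / 4) / ?n"
    by (intro divide_right_mono mult_left_mono norm_start_le) auto
  moreover have "3 * (R\<^sup>2 / 4) / ?n = 3 / 4 * (R\<^sup>2 / ?n)"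
    by simp
  ultimately have "(norm (iter z0 j - iter z0 (Suc j)))\<^sup>2 \<le> 3 / 4 * (d\<^sup>2 / 1024)"
    using norm_step_le[OF opt, of z0 j] by linarith
  also have "\<dots> \<le> (d / 16)\<^sup>2"
    by (simp add: power_divide)
  finally show "(norm (iter z0 j - iter z0 (Suc j)))\<^sup>2 \<le> (d / 16)\<^sup>2" .
qed (use d_pos in simp)

text \<open>This uses the other entry of the maximum. The residual at \<open>Suc j\<close> comes
  from the step leaving \<open>j\<close>, and \<open>27 / 8 / 256 < 1 / 64\<close> gives the strict
  bound.\<close>

lemma infdist_cone_less:
  assumes "K0 \<le> real (Suc j)"
  shows "infdist (iter z0 (Suc j) - zs) (sharpness_cone A b c R zs) < d / 8"
proof -
  let ?n = "real (Suc j)" and ?z = "iter z0 (Suc j)"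
    and ?I = "infdist (iter z0 (Suc j) - zs) (sharpness_cone A b c R zs)"
  let ?r = "iter z0 j - ?z"
  let ?res = "sharpness_residual A b c R zs (fst (?z - zs)) (snd (?z - zs))"
  have \<alpha>: "0 < \<alpha>" and "\<alpha> * ?I \<le> norm ?res"
    using sharp unfolding sharpness_constant_def by (blast, metis prod.collapse)
  then have "(\<alpha> * ?I)\<^sup>2 \<le> (norm ?res)\<^sup>2"
    by (intro power_mono) (auto simp: infdist_nonneg)
  also have "\<dots> \<le> 2 * (norm ((1 / s) *\<^sub>R Q ?r))\<^sup>2"
  proof (rule norm_sharpness_residual_le[OF opt kkt_residual_iter _ R_pos])
    have "norm ?z \<le> norm (?z - zs) + norm zs"
      using norm_triangle_ineq[of "?z - zs" zs] by simp
    then show "norm ?z \<le> R"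
      using norm_dist_le[OF opt, of z0 "Suc j"] by (simp add: R_eq del: pdhg.simps)
        (smt (verit) norm_ge_zero)
  qed
  also have "\<dots> = 2 / s\<^sup>2 * (norm (Q ?r))\<^sup>2"
    by (simp add: power_divide power_mult_distrib)
  also have "\<dots> \<le> 2 / s\<^sup>2 * (9 / 4 * (norm ?r)\<^sup>2)"
    using power_mono[OF norm_Q_le[of ?r], of 2]
    by (intro mult_left_mono) (simp_all add: power_mult_distrib power_divide)
  also have "\<dots> \<le> 2 / s\<^sup>2 * (9 / 4 * (3 * (norm (z0 - zs))\<^sup>2 / ?n))"
    by (intro mult_left_mono norm_step_le[OF opt]) auto
  also have "\<dots> \<le> 2 / s\<^sup>2 * (9 / 4 * (3 * (R\<^sup>2 / 4) / ?n))"
    by (intro mult_left_mono divide_right_mono norm_start_le) auto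
  also have "\<dots> = \<alpha>\<^sup>2 * (27 / 8 * (R\<^sup>2 / (s\<^sup>2 * \<alpha>\<^sup>2) / ?n))"
    using \<alpha> s_pos by (simp add: divide_simps)
  also have "\<dots> \<le> \<alpha>\<^sup>2 * (27 / 8 * (d\<^sup>2 / 256))"
  proof -
    have "1 / (s\<^sup>2 * \<alpha>\<^sup>2) * (256 * R\<^sup>2 / d\<^sup>2) \<le> K0"
      unfolding K0_def by (intro mult_right_mono) auto
    then have "R\<^sup>2 / (s\<^sup>2 * \<alpha>\<^sup>2) * 256 / d\<^sup>2 \<le> ?n"
      using assms by (simp add: algebra_simps)
    then have "R\<^sup>2 / (s\<^sup>2 * \<alpha>\<^sup>2) * 256 \<le> ?n * d\<^sup>2"
      by (subst (asm) pos_divide_le_eq) (use d_pos in auto)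
    then have "R\<^sup>2 / (s\<^sup>2 * \<alpha>\<^sup>2) / ?n \<le> d\<^sup>2 / 256"
      by (subst pos_divide_le_eq) (auto simp: mult.commute)
    then show ?thesis
      by (intro mult_left_mono) auto
  qed
  also have "\<dots> < \<alpha>\<^sup>2 * (d / 8)\<^sup>2"
    using \<alpha> d_pos by (intro mult_strict_left_mono) (auto simp: power_divide)
  finally have "?I\<^sup>2 < (d / 8)\<^sup>2"
    using \<alpha> by (simp add: power_mult_distrib)
  then show ?thesis
    by (rule power2_less_imp_less) (use d_pos in simp)
qed

text \<open>A nearby cone point \<open>p\<close> has norm below \<open>9 / 16 * d + d / 8\<close>,
  hence at most \<open>d\<close>, so \<open>zs + p\<close> is optimal. Comparison with the limit
  then gives \<open>12 / 64 \<le> 1 / 4\<close> for the squares.\<close>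

lemma dist_improve:
  assumes "K0 \<le> real (Suc j)" "norm (iter z0 (Suc j) - zs) \<le> d / 2 + d / 16"
  shows "norm (iter z0 (Suc j) - zs) \<le> d / 2"
proof (rule power2_le_imp_le)
  let ?z = "iter z0 (Suc j)" and ?S = "sharpness_cone A b c R zs"
  have "0 \<in> ?S" by (simp add: sharpness_cone_def zero_prod_def)
  then obtain p where p: "p \<in> ?S" "dist (?z - zs) p < d / 8"
    using infdist_less_obtain[OF infdist_cone_less[OF assms(1)]] by blast
  have "norm p \<le> norm (?z - zs) + dist (?z - zs) p"
    unfolding dist_norm by (rule norm_triangle_sub[of p "?z - zs", folded norm_minus_commute[of _ p]])
  then have "norm p \<le> d"
    using p(2) assms(2) d_pos by linarith
  then have "optimal_solution A b c (zs + p)"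
    using sharpness_cone_optimal[OF opt p(1) R_pos] d_N d_B1 by blast
  then have "(norm (?z - zs))\<^sup>2 \<le> 12 * (norm (?z - (zs + p)))\<^sup>2"
    by (rule norm_limit_le[OF lim])
  also have "norm (?z - (zs + p)) = dist (?z - zs) p"
    by (simp add: dist_norm algebra_simps)
  also have "12 * (dist (?z - zs) p)\<^sup>2 \<le> 12 * (d / 8)\<^sup>2"
    using p(2) by (intro mult_left_mono power_mono) auto
  also have "\<dots> \<le> (d / 2)\<^sup>2"
    by (simp add: power_divide)
  finally show "(norm (?z - zs))\<^sup>2 \<le> (d / 2)\<^sup>2" .
qed (use d_pos in simp)

text \<open>Once within \<open>d / 2\<close> of the limit forever, the bound propagates backwards down to \<open>K0\<close>:
  the previous iterate is at most one short step further away, so it is still in the region where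
  the sharpness cone consists of displacements to optimal solutions.\<close>

lemma dist_le_half:
  assumes "K0 \<le> real j"
  shows "norm (iter z0 j - zs) \<le> d / 2"
proof -
  obtain J where J: "\<And>n. J \<le> n \<Longrightarrow> norm (iter z0 n - zs) < d / 2"
    using LIMSEQ_D[OF lim, of "d / 2"] d_pos by auto
  have "j \<le> max j J" by simp
  then show ?thesis
  proof (induction rule: inc_induct)
    case base
    then show ?case using J[of "max j J"] by (simp add: less_imp_le)
  next
    case (step n)
    then have Kn: "K0 \<le> real n" using assms by linarith
    \<comment> \<open>A residual is available only after a step; \<open>K0 > 0\<close> excludes the
      starting point.\<close>
    then obtain m where n: "n = Suc m"
      using K0_pos by (cases n) auto
    have "norm (iter z0 n - zs) \<le> norm (iter z0 n - iter z0 (Suc n)) + norm (iter z0 (Suc n) - zs)"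
      using norm_triangle_ineq[of "iter z0 n - iter z0 (Suc n)" "iter z0 (Suc n) - zs"]
      by (simp del: pdhg.simps)
    also have "\<dots> \<le> d / 2 + d / 16"
      using step_small[of n] step.IH Kn by simp
    finally show ?case
      using dist_improve[of m] Kn n by simp
  qed
qed

lemma reduced_cost_near:
  assumes "norm (z - zs) \<le> d / 2" "i \<in> idx_N A c zs"
  shows "op_norm A * d / 2 \<le> reduced_cost A c (snd z) i"
proof -
  have "norm (snd z - snd zs) \<le> d / 2"
    using norm_snd_le[of "snd (z - zs)" "fst (z - zs)", unfolded prod.collapse] assms(1) by simp
  then have "op_norm A * norm (snd z - snd zs) \<le> op_norm A * (d / 2)"
    by (intro mult_left_mono op_norm_nonneg)
  then have "column i A \<bullet> (snd z - snd zs) \<le> op_norm A * (d / 2)"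
    using abs_column_inner_le[of i A "snd z - snd zs"] by linarith
  then show ?thesis
    using d_N[OF assms(2)] by (simp add: reduced_cost_def inner_diff_right algebra_simps)
qed

lemma fst_near:
  assumes "norm (z - zs) \<le> d / 2"
  shows "\<bar>fst z $ i - fst zs $ i\<bar> \<le> d / 2"
proof -
  have "\<bar>(fst z - fst zs) $ i\<bar> \<le> norm (fst z - fst zs)"
    by (rule component_le_norm_cart)
  then show ?thesis
    using norm_fst_le[of "fst (z - zs)" "snd (z - zs)", unfolded prod.collapse] assms by simp
qed

text \<open>Inside the ball the reduced cost stays above half its guaranteed value, so each step
  subtracts at least a fixed amount before truncation at zero.\<close>

lemma nonbasic_decrease:
  assumes "K0 \<le> real j" "i \<in> idx_N A c zs"
  shows "fst (iter z0 (j + m)) $ i \<le> max 0 (d / 2 - real m * (s * (op_norm A * d / 2)))"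
proof (induction m)
  case 0
  have "fst zs $ i = 0"
    using optimal_fst_eq_0[OF opt] assms(2) by simp
  then show ?case
    using fst_near[OF dist_le_half[OF assms(1)], of i] by simp
next
  case (Suc m)
  let ?e = "s * (op_norm A * d / 2)"
  have "op_norm A * d / 2 \<le> reduced_cost A c (snd (iter z0 (j + m))) i"
    using assms by (intro reduced_cost_near dist_le_half) auto
  then have "?e \<le> s * reduced_cost A c (snd (iter z0 (j + m))) i"
    using s_pos by (intro mult_left_mono) auto
  moreover have "0 \<le> ?e"
    using s_pos d_pos by (simp add: op_norm_nonneg)
  moreover have "real (Suc m) * ?e = real m * ?e + ?e"
    by (simp add: algebra_simps)
  ultimately show ?case
    using Suc by (simp only: add_Suc_right pdhg.simps fst_pdhg_step)
qed

lemma nonbasic_eq_0: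
  assumes "A \<noteq> 0" "K0 + 2 / (s * op_norm A) \<le> real k" "i \<in> idx_N A c zs"
  shows "fst (iter z0 k) $ i = 0"
proof -
  let ?q = "1 / (s * op_norm A)"
  define j where "j = nat \<lceil>K0\<rceil>"
  have sa: "0 < s * op_norm A"
    using s_pos op_norm_pos[OF assms(1)] by simp
  \<comment> \<open>Of the \<open>2 * ?q\<close> extra steps, one \<open>?q\<close> covers rounding
    \<open>K0\<close> up to \<open>j\<close>; the other suffices to remove the initial
    \<open>d / 2\<close>.\<close>
  then have q: "2 \<le> ?q"
    using s_op_norm by (simp add: field_simps)
  have j: "K0 \<le> real j" "real j \<le> K0 + 1"
    using K0_pos by (simp_all add: j_def)
  have k: "K0 + 2 * ?q \<le> real k" using assms(2) by simp
  define m where "m = k - j"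
  have "j \<le> k" using j k q by linarith
  then have km: "k = j + m" by (simp add: m_def)
  have "?q \<le> real m" using j k q km by simp
  then have "1 \<le> real m * (s * op_norm A)"
    using sa by (simp add: field_simps)
  then have "1 * (d / 2) \<le> real m * (s * op_norm A) * (d / 2)"
    using d_pos by (intro mult_right_mono) auto
  then have "d / 2 - real m * (s * (op_norm A * d / 2)) \<le> 0"
    by (simp add: mult.assoc)
  then have "fst (iter z0 k) $ i \<le> 0"
    using nonbasic_decrease[OF j(1) assms(3), of m] by (simp add: km)
  \<comment> \<open>The initial point is arbitrary; nonnegativity needs at least one
    projection.\<close>
  moreover obtain l where "k = Suc l"
    using k q K0_pos by (cases k) auto
  then have "0 \<le> fst (iter z0 k) $ i"
    by (simp add: fst_pdhg_step)
  ultimately show ?thesis by simp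
qed

end

section \<open>Extended-real non-degeneracy metric and conclusion\<close>

lemma nondegeneracy_pos:
  assumes "A \<noteq> 0"
  shows "0 < nondegeneracy A c z"
proof -
  have "0 < (INF i\<in>I. ereal (f i))" if "\<And>i. i \<in> I \<Longrightarrow> 0 < f i" for I :: "'k::finite set" and f
    using that by (cases "I = {}") (auto simp: finite_less_Inf_iff top_ereal_def)
  from this[of "idx_N A c z"] this[of "idx_B1 A c z"] show ?thesis
    using op_norm_pos[OF assms] by (simp add: nondegeneracy_def idx_N_def idx_B1_def)
qed

lemma nondegeneracy_le:
  "i \<in> idx_N A c z \<Longrightarrow> nondegeneracy A c z \<le> ereal (reduced_cost A c (snd z) i / op_norm A)"
  "i \<in> idx_B1 A c z \<Longrightarrow> nondegeneracy A c z \<le> ereal (fst z $ i)"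
  by (auto simp: nondegeneracy_def intro: min.coboundedI1 min.coboundedI2 INF_lower)

theorem theorem2:
  fixes A :: "real^'n^'m" and b :: "real^'m" and c :: "real^'n"
    and s R \<alpha> :: real and \<delta> :: ereal
    and z0 zs :: "(real^'n) \<times> (real^'m)" and k :: nat
  assumes "A \<noteq> 0"
    and "lp_feasible A b" and "lp_bounded A b c"
    and "0 < s" and "s \<le> 1 / (2 * op_norm A)"
    and "optimal_solution A b c zs"
    and "(\<lambda>j. pdhg A b c s z0 j) \<longlonglongrightarrow> zs"
    and "\<delta> = nondegeneracy A c zs"
    and "R = 2 * (norm (z0 - zs) + norm zs) + 1"
    and "sharpness_constant A b c R zs \<alpha>"
    and "ereal (real k) \<ge>
           ereal (max 4 (1 / (s\<^sup>2 * \<alpha>\<^sup>2))) * (ereal (256 * R\<^sup>2) / \<delta>\<^sup>2)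
           + ereal (2 / (s * op_norm A))"
  shows "ereal (norm (pdhg A b c s z0 k - zs)) \<le> \<delta> / 2 \<and>
         (\<forall>i\<in>idx_N A c zs. fst (pdhg A b c s z0 k) $ i = 0) \<and>
         (\<forall>i\<in>idx_B1 A c zs. fst (pdhg A b c s z0 k) $ i > 0) \<and>
         (\<forall>i\<in>idx_N A c zs. reduced_cost A c (snd (pdhg A b c s z0 k)) i > 0)"
proof (cases \<delta>)
  case (real d)
  have a: "0 < op_norm A"
    by (rule op_norm_pos[OF assms(1)])
  have d: "0 < d"
    using nondegeneracy_pos[OF assms(1), of c zs] unfolding assms(8)[symmetric] real by simp
  interpret pdhg_limit A b c s z0 zs R \<alpha> d
  proof unfold_locales
    show "s * op_norm A \<le> 1 / 2"
      using assms(5) a by (simp add: field_simps)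
    show "d * op_norm A \<le> reduced_cost A c (snd zs) i" if "i \<in> idx_N A c zs" for i
      using nondegeneracy_le(1)[OF that, folded assms(8), unfolded real] a by (simp add: field_simps)
    show "d \<le> fst zs $ i" if "i \<in> idx_B1 A c zs" for i
      using nondegeneracy_le(2)[OF that, folded assms(8), unfolded real] by simp
  qed (use assms d in auto)
  have "ereal (256 * R\<^sup>2) / \<delta>\<^sup>2 = ereal (256 * R\<^sup>2 / d\<^sup>2)"
    using d by (simp add: real)
  then have "ereal (real k) \<ge> ereal (K0 + 2 / (s * op_norm A))"
    using assms(11) by (simp only: K0_def times_ereal.simps plus_ereal.simps)
  then have k: "K0 + 2 / (s * op_norm A) \<le> real k" by simp
  moreover have "0 < 2 / (s * op_norm A)"
    using s_pos a by simp
  ultimately have near: "norm (iter z0 k - zs) \<le> d / 2"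
    by (intro dist_le_half) linarith
  have "0 < fst (iter z0 k) $ i" if "i \<in> idx_B1 A c zs" for i
    using fst_near[OF near, of i] d_B1[OF that] d by linarith
  moreover have "0 < reduced_cost A c (snd (iter z0 k)) i" if "i \<in> idx_N A c zs" for i
    using reduced_cost_near[OF near that] mult_pos_pos[OF a d] by linarith
  ultimately show ?thesis
    using near nonbasic_eq_0[OF assms(1) k] by (simp add: real)
next
  \<comment> \<open>Both index sets are empty here, so the sign claims are vacuous and the distance
    bound is infinite.\<close>
  case PInf
  then have "idx_N A c zs = {}" "idx_B1 A c zs = {}"
    using nondegeneracy_le[where A = A and c = c and z = zs] assms(8) by auto
  then show ?thesis by (simp add: PInf)
next
  case MInf
  then show ?thesis
    using nondegeneracy_pos[OF assms(1), of c zs] assms(8) by simp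
qed

end
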